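(* Let $x>0$ and let $\Pi_{\rm RS}(x)=\mathbb P\{X_i\le x\}$ be the outage probability of a randomly (uniformly, independently of the channels) selected device. With all other parameters fixed, $$\Pi^\infty_{\rm RS}(x):=\lim_{P_t\to\infty}\Pi_{\rm RS}(x)=1-\exp\left(-\frac{\sigma_n^2ct_2x}{t_1(ac-b)}\right).$$
   Context: There are $M\ge 1$ devices. The channel gains $|g_1|^2,\dots,|g_M|^2,|h_1|^2,\dots,|h_M|^2$ are independent exponential random variables with mean $1$. Parameters: $P_t>0$, $\sigma_n^2>0$, $0<t_1<1$, $t_2=1-t_1$, and real constants $a,b,c$ with $c>0$ and $ac-b>0$. The energy harvested by device $i$ is $E_i=t_1\left(\frac{aP_t|g_i|^2+b}{P_t|g_i|^2+c}-\frac bc\right)$, and the SNR of device $i$ is $X_i=\frac{|h_i|^2}{t_2\sigma_n^2}E_i$. *)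

theory Defs
  imports "HOL-Probability.Probability"
begin

definition harvested_energy ::
    "real \<Rightarrow> real \<Rightarrow> real \<Rightarrow> real \<Rightarrow> real \<Rightarrow> complex \<Rightarrow> real" where
  "harvested_energy a b c t\<^sub>1 P\<^sub>t g =
     t\<^sub>1 * ((a * P\<^sub>t * (cmod g)\<^sup>2 + b) / (P\<^sub>t * (cmod g)\<^sup>2 + c) - b / c)"

definition snr ::
    "real \<Rightarrow> real \<Rightarrow> real \<Rightarrow> real \<Rightarrow> real \<Rightarrow> real \<Rightarrow> real \<Rightarrow> complex \<Rightarrow> complex \<Rightarrow> real" where
  "snr a b c \<sigma> t\<^sub>1 t\<^sub>2 P\<^sub>t g h =
     (cmod h)\<^sup>2 / (t\<^sub>2 * \<sigma>\<^sup>2) * harvested_energy a b c t\<^sub>1 P\<^sub>t g"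

text \<open>All \<open>2 * M\<close> channel gains as one family: index \<open>Inl i\<close> is the gain of \<open>g\<^sub>i\<close>,
  index \<open>Inr i\<close> the gain of \<open>h\<^sub>i\<close>.\<close>

definition channel_gain ::
    "(nat \<Rightarrow> 'w \<Rightarrow> complex) \<Rightarrow> (nat \<Rightarrow> 'w \<Rightarrow> complex) \<Rightarrow> nat + nat \<Rightarrow> 'w \<Rightarrow> real" where
  "channel_gain g h k \<omega> = (case k of Inl i \<Rightarrow> (cmod (g i \<omega>))\<^sup>2 | Inr i \<Rightarrow> (cmod (h i \<omega>))\<^sup>2)"

definition channel_indices :: "nat \<Rightarrow> (nat + nat) set" where
  "channel_indices M = {1..M} <+> {1..M}"

definition iid_exponential_gains ::
    "'w measure \<Rightarrow> nat \<Rightarrow> (nat \<Rightarrow> 'w \<Rightarrow> complex) \<Rightarrow> (nat \<Rightarrow> 'w \<Rightarrow> complex) \<Rightarrow> bool" where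
  "iid_exponential_gains \<Omega> M g h \<longleftrightarrow>
     prob_space.indep_vars \<Omega> (\<lambda>_. borel) (channel_gain g h) (channel_indices M) \<and>
     (\<forall>k\<in>channel_indices M. distributed \<Omega> lborel (channel_gain g h k) (exponential_density 1))"

text \<open>The index \<open>S\<close> of the selected device is uniform on \<open>{1..M}\<close> and independent of the
  joint vector of all channel gains.  Independence is that of the generated sigma-algebras,
  because \<open>indep_var\<close> needs both random variables to have the same type.  The range of \<open>S\<close> is
  constrained everywhere, not just almost surely: for \<open>i\<close> outside \<open>{1..M}\<close> nothing is known
  about \<open>g i\<close> and \<open>h i\<close>, so the outage event could fail to be measurable.\<close>

definition random_selection ::
    "'w measure \<Rightarrow> nat \<Rightarrow> (nat \<Rightarrow> 'w \<Rightarrow> complex) \<Rightarrow> (nat \<Rightarrow> 'w \<Rightarrow> complex) \<Rightarrow> ('w \<Rightarrow> nat) \<Rightarrow> bool" where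
  "random_selection \<Omega> M g h S \<longleftrightarrow>
     S \<in> \<Omega> \<rightarrow>\<^sub>M count_space UNIV \<and>
     S ` space \<Omega> \<subseteq> {1..M} \<and>
     distr \<Omega> (count_space UNIV) S = measure_pmf (pmf_of_set {1..M}) \<and>
     prob_space.indep_set \<Omega>
       (sets (vimage_algebra (space \<Omega>) S (count_space UNIV)))
       (sets (vimage_algebra (space \<Omega>)
         (\<lambda>\<omega>. \<lambda>k\<in>channel_indices M. channel_gain g h k \<omega>)
         (Pi\<^sub>M (channel_indices M) (\<lambda>_. borel))))"

definition outage_RS ::
    "'w measure \<Rightarrow> (nat \<Rightarrow> 'w \<Rightarrow> complex) \<Rightarrow> (nat \<Rightarrow> 'w \<Rightarrow> complex) \<Rightarrow> ('w \<Rightarrow> nat) \<Rightarrow>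
     real \<Rightarrow> real \<Rightarrow> real \<Rightarrow> real \<Rightarrow> real \<Rightarrow> real \<Rightarrow> real \<Rightarrow> real \<Rightarrow> real" where
  "outage_RS \<Omega> g h S a b c \<sigma> t\<^sub>1 t\<^sub>2 P\<^sub>t x =
     \<P>(\<omega> in \<Omega>. snr a b c \<sigma> t\<^sub>1 t\<^sub>2 P\<^sub>t (g (S \<omega>) \<omega>) (h (S \<omega>) \<omega>) \<le> x)"

end

(* The SNR of device i is K * |h_i|^2 * (P u / (P u + c)) with u = |g_i|^2 and
   K = t1 (a c - b) / (c t2 sigma^2), so it tends to K * |h_i|^2 wherever g_i is nonzero, that is
   almost surely. The limit has a continuous distribution, so dominated convergence of the
   indicators of the outage events gives the limit of the outage probability of each single device,
   and the random selection only averages these equal limits. *)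
theory Submission
  imports Defs "HOL-Real_Asymp.Real_Asymp"
begin

text \<open>Over the common denominator the terms \<open>b * c\<close> cancel, which leaves
  \<open>(a * c - b)\<close> times the received power. All dependence on \<open>P\<close> then sits
  in one factor that increases to 1.\<close>

lemma snr_eq_saturating:
  assumes "c > 0" and "P \<ge> 0"
  shows "snr a b c \<sigma> t\<^sub>1 t\<^sub>2 P g h =
    t\<^sub>1 * (a * c - b) / (c * (t\<^sub>2 * \<sigma>\<^sup>2)) * (cmod h)\<^sup>2 *
      (P * (cmod g)\<^sup>2 / (P * (cmod g)\<^sup>2 + c))"
proof -
  have pos: "P * (cmod g)\<^sup>2 + c > 0"
    using assms by (simp add: add_nonneg_pos)
  have "(a * P * (cmod g)\<^sup>2 + b) / (P * (cmod g)\<^sup>2 + c) - b / c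
      = (a * c - b) / c * (P * (cmod g)\<^sup>2 / (P * (cmod g)\<^sup>2 + c))"
    using assms pos by (simp add: divide_simps) (simp add: algebra_simps)
  then show ?thesis
    by (simp add: snr_def harvested_energy_def mult_ac)
qed

text \<open>A nonzero \<open>g\<close> makes the received power grow without bound, so the
  saturating factor tends to 1; at \<open>g = 0\<close> it would be 0 for every
  \<open>P\<close>.\<close>

lemma tendsto_snr_at_top:
  assumes "c > 0" and "g \<noteq> 0"
  shows "((\<lambda>P. snr a b c \<sigma> t\<^sub>1 t\<^sub>2 P g h) \<longlongrightarrow>
    t\<^sub>1 * (a * c - b) / (c * (t\<^sub>2 * \<sigma>\<^sup>2)) * (cmod h)\<^sup>2) at_top"
proof -
  have u: "(cmod g)\<^sup>2 > 0"
    using assms by simp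
  have "((\<lambda>P. P * (cmod g)\<^sup>2 / (P * (cmod g)\<^sup>2 + c)) \<longlongrightarrow> 1) at_top"
    using u \<open>c > 0\<close> by real_asymp
  then have lim: "((\<lambda>P. t\<^sub>1 * (a * c - b) / (c * (t\<^sub>2 * \<sigma>\<^sup>2)) * (cmod h)\<^sup>2 *
      (P * (cmod g)\<^sup>2 / (P * (cmod g)\<^sup>2 + c))) \<longlongrightarrow>
      t\<^sub>1 * (a * c - b) / (c * (t\<^sub>2 * \<sigma>\<^sup>2)) * (cmod h)\<^sup>2 * 1) at_top"
    by (rule tendsto_mult_left)
  \<comment> \<open>The closed form is available for nonnegative \<open>P\<close>, where the
    denominator is positive; this covers all large \<open>P\<close>.\<close>
  have "\<forall>\<^sub>F P in at_top. t\<^sub>1 * (a * c - b) / (c * (t\<^sub>2 * \<sigma>\<^sup>2)) * (cmod h)\<^sup>2 *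
      (P * (cmod g)\<^sup>2 / (P * (cmod g)\<^sup>2 + c)) = snr a b c \<sigma> t\<^sub>1 t\<^sub>2 P g h"
    using eventually_ge_at_top[of 0] by eventually_elim (simp add: snr_eq_saturating[OF \<open>c > 0\<close>])
  from Lim_transform_eventually[OF lim this] show ?thesis
    by simp
qed

text \<open>Where the limit differs from \<open>x\<close>, \<open>X P\<close> eventually lies on the
  same side of \<open>x\<close> as \<open>Z\<close>, so the indicators of the two events eventually
  agree. Dominated convergence with the constant bound 1 does the rest.\<close>

lemma (in prob_space) tendsto_prob_le_at_top:
  fixes X :: "real \<Rightarrow> 'a \<Rightarrow> real"
  assumes [measurable]: "\<And>P. random_variable borel (X P)" "random_variable borel Z"
    and lim: "AE \<omega> in M. ((\<lambda>P. X P \<omega>) \<longlongrightarrow> Z \<omega>) at_top"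
    and no_atom: "AE \<omega> in M. Z \<omega> \<noteq> x"
  shows "((\<lambda>P. \<P>(\<omega> in M. X P \<omega> \<le> x)) \<longlongrightarrow> \<P>(\<omega> in M. Z \<omega> \<le> x)) at_top"
proof -
  have "((\<lambda>P. \<integral>\<omega>. indicator {..x} (X P \<omega>) \<partial>M) \<longlongrightarrow>
      (\<integral>\<omega>. indicator {..x} (Z \<omega>) \<partial>M :: real)) at_top"
  proof (rule integral_dominated_convergence_at_top[where w = "\<lambda>_. 1"])
    show "AE \<omega> in M. ((\<lambda>P. indicator {..x} (X P \<omega>)) \<longlongrightarrow> (indicator {..x} (Z \<omega>) :: real)) at_top"
      using lim no_atom
    proof eventually_elim
      case (elim \<omega>)
      have "\<forall>\<^sub>F P in at_top. (indicator {..x} (X P \<omega>) :: real) = indicator {..x} (Z \<omega>)"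
      proof (cases "Z \<omega> < x")
        case True
        from order_tendstoD(2)[OF elim(1) this] show ?thesis
          by eventually_elim (use True in simp)
      next
        case False
        then have "x < Z \<omega>" using elim(2) by simp
        from order_tendstoD(1)[OF elim(1) this] show ?thesis
          by eventually_elim (use \<open>x < Z \<omega>\<close> in simp)
      qed
      then show ?case by (rule tendsto_eventually)
    qed
  qed (auto split: split_indicator)
  \<comment> \<open>Stated for an arbitrary variable, to serve both for each \<open>X P\<close> and
    for \<open>Z\<close>.\<close>
  moreover have "(\<integral>\<omega>. indicator {..x} (Y \<omega>) \<partial>M) = \<P>(\<omega> in M. Y \<omega> \<le> x)"
    if [measurable]: "random_variable borel Y" for Y :: "'a \<Rightarrow> real"
  proof -
    have "(\<integral>\<omega>. indicator {..x} (Y \<omega>) \<partial>M) = (\<integral>\<omega>. indicator {\<omega>\<in>space M. Y \<omega> \<le> x} \<omega> \<partial>M :: real)"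
      by (rule Bochner_Integration.integral_cong) (auto split: split_indicator)
    also have "\<dots> = \<P>(\<omega> in M. Y \<omega> \<le> x)"
      by simp
    finally show ?thesis .
  qed
  ultimately show ?thesis by simp
qed

text \<open>A law with a Lebesgue density has no atoms. This serves twice: at 0 it excludes a
  vanishing channel \<open>g\<close>, and at a positive point it makes the limiting distribution
  continuous.\<close>

lemma distributed_lborel_AE_neq:
  fixes Y :: "'a \<Rightarrow> real"
  assumes "distributed M lborel Y f"
  shows "AE \<omega> in M. Y \<omega> \<noteq> y"
proof -
  have [measurable]: "f \<in> borel_measurable borel"
    using distributed_borel_measurable[OF assms] by simp
  have "AE z in density lborel f. z \<noteq> y"
    using AE_lborel_singleton[of y] by (simp add: AE_density) (auto elim: eventually_mono)
  then have "AE z in distr M lborel Y. z \<noteq> y"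
    by (simp only: distributed_distr_eq_density[OF assms])
  from AE_distrD[OF distributed_measurable[OF assms] this] show ?thesis .
qed

text \<open>The almost sure limit of the SNR is a positive multiple of the gain of \<open>h\<close>,
  so the limiting outage probability is an exponential distribution function at a rescaled
  threshold.\<close>

lemma (in prob_space) tendsto_device_outage:
  assumes u: "distributed M lborel (\<lambda>\<omega>. (cmod (g \<omega>))\<^sup>2) (exponential_density 1)"
    and v: "distributed M lborel (\<lambda>\<omega>. (cmod (h \<omega>))\<^sup>2) (exponential_density 1)"
    and "\<sigma>\<^sup>2 > 0" "t\<^sub>1 > 0" "t\<^sub>2 > 0" "c > 0" "a * c - b > 0" "x \<ge> 0"
  shows "((\<lambda>P. \<P>(\<omega> in M. snr a b c \<sigma> t\<^sub>1 t\<^sub>2 P (g \<omega>) (h \<omega>) \<le> x)) \<longlongrightarrow>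
    1 - exp (- (\<sigma>\<^sup>2 * c * t\<^sub>2 * x) / (t\<^sub>1 * (a * c - b)))) at_top"
proof -
  define K where "K = t\<^sub>1 * (a * c - b) / (c * (t\<^sub>2 * \<sigma>\<^sup>2))"
  have K: "K > 0"
    using assms by (simp add: K_def)
  \<comment> \<open>Measurability is known for the squared moduli, not for \<open>g\<close> and
    \<open>h\<close> themselves; once unfolded, the SNR involves only these moduli.\<close>
  have [measurable]: "random_variable borel (\<lambda>\<omega>. (cmod (g \<omega>))\<^sup>2)"
      "random_variable borel (\<lambda>\<omega>. (cmod (h \<omega>))\<^sup>2)"
    using u v by (auto simp: distributed_def)
  have lim: "((\<lambda>P. \<P>(\<omega> in M. snr a b c \<sigma> t\<^sub>1 t\<^sub>2 P (g \<omega>) (h \<omega>) \<le> x)) \<longlongrightarrow>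
      \<P>(\<omega> in M. K * (cmod (h \<omega>))\<^sup>2 \<le> x)) at_top"
  proof (rule tendsto_prob_le_at_top)
    show "random_variable borel (\<lambda>\<omega>. snr a b c \<sigma> t\<^sub>1 t\<^sub>2 P (g \<omega>) (h \<omega>))" for P
      unfolding snr_def harvested_energy_def by measurable
    show "random_variable borel (\<lambda>\<omega>. K * (cmod (h \<omega>))\<^sup>2)"
      by measurable
    show "AE \<omega> in M. ((\<lambda>P. snr a b c \<sigma> t\<^sub>1 t\<^sub>2 P (g \<omega>) (h \<omega>)) \<longlongrightarrow> K * (cmod (h \<omega>))\<^sup>2) at_top"
      using distributed_lborel_AE_neq[OF u, of 0]
      unfolding K_def by eventually_elim (rule tendsto_snr_at_top, use \<open>c > 0\<close> in auto)
    show "AE \<omega> in M. K * (cmod (h \<omega>))\<^sup>2 \<noteq> x"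
      using distributed_lborel_AE_neq[OF v, of "x / K"]
      by eventually_elim (use K in \<open>auto simp: field_simps\<close>)
  qed
  have "\<P>(\<omega> in M. K * (cmod (h \<omega>))\<^sup>2 \<le> x) = \<P>(\<omega> in M. (cmod (h \<omega>))\<^sup>2 \<le> x / K)"
    using K by (simp add: field_simps)
  \<comment> \<open>The exponential distribution function has this form at nonnegative arguments,
    hence \<open>x \<ge> 0\<close> and \<open>K > 0\<close>.\<close>
  also have "\<dots> = 1 - exp (- (x / K) * 1)"
    using exponential_distributedD_le[OF v, of "x / K"] K \<open>x \<ge> 0\<close> by simp
  also have "\<dots> = 1 - exp (- (\<sigma>\<^sup>2 * c * t\<^sub>2 * x) / (t\<^sub>1 * (a * c - b)))"
    by (simp add: K_def mult_ac)
  finally show ?thesis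
    using lim by simp
qed

text \<open>Split by the value of \<open>S\<close>: on \<open>S = i\<close> the event is
  \<open>E i\<close>, and independence gives each piece the weight
  \<open>1 / card I\<close>.\<close>

lemma (in prob_space) prob_uniform_selection:
  fixes S :: "'a \<Rightarrow> nat"
  assumes S: "S \<in> measurable M (count_space UNIV)" "S ` space M \<subseteq> I"
    and I: "finite I" "I \<noteq> {}"
    and unif: "distr M (count_space UNIV) S = measure_pmf (pmf_of_set I)"
    and indep: "indep_set (sets (vimage_algebra (space M) S (count_space UNIV))) F"
    and E: "\<And>i. i \<in> I \<Longrightarrow> {\<omega>\<in>space M. E i \<omega>} \<in> F"
  shows "\<P>(\<omega> in M. E (S \<omega>) \<omega>) = (\<Sum>i\<in>I. \<P>(\<omega> in M. E i \<omega>)) / card I"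
proof -
  let ?S = "\<lambda>i. S -` {i} \<inter> space M"
  let ?E = "\<lambda>i. {\<omega>\<in>space M. E i \<omega>}"
  \<comment> \<open>Independence of two families already includes that their members are
    events.\<close>
  have E_events: "?E i \<in> events" if "i \<in> I" for i
    using indep E[OF that] unfolding indep_set_def indep_sets_def UNIV_bool by auto
  have S_events: "?S i \<in> events" for i
    using S(1) by (rule measurable_sets) simp
  have S_prob: "prob (?S i) = 1 / card I" if "i \<in> I" for i
  proof -
    have "prob (?S i) = measure (distr M (count_space UNIV) S) {i}"
      using S(1) by (simp add: measure_distr)
    also have "\<dots> = 1 / card I"
      using I that by (simp add: unif measure_pmf_single)
    finally show ?thesis .
  qed
  have prod: "prob (?S i \<inter> ?E i) = prob (?E i) / card I" if "i \<in> I" for i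
    using indep_setD[OF indep in_vimage_algebra E[OF that], of "{i}"] S_prob[OF that] by simp
  \<comment> \<open>An exact equality of sets, because \<open>S\<close> takes values in
    \<open>I\<close> everywhere.\<close>
  have "{\<omega>\<in>space M. E (S \<omega>) \<omega>} = (\<Union>i\<in>I. ?S i \<inter> ?E i)"
    using S(2) by auto
  also have "prob \<dots> = (\<Sum>i\<in>I. prob (?S i \<inter> ?E i))"
    using S_events E_events by (intro finite_measure_finite_Union I(1)) (auto simp: disjoint_family_on_def)
  also have "\<dots> = (\<Sum>i\<in>I. \<P>(\<omega> in M. E i \<omega>)) / card I"
    by (simp add: prod sum_divide_distrib)
  finally show ?thesis .
qed

text \<open>The point is that each single-device outage event lies in the sigma-algebra generated by
  the joint gain vector, the one from which \<open>S\<close> is independent.\<close>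

lemma outage_RS_eq_average:
  assumes "prob_space \<Omega>" and "M \<ge> 1" and sel: "random_selection \<Omega> M g h S"
  shows "outage_RS \<Omega> g h S a b c \<sigma> t\<^sub>1 t\<^sub>2 P x =
    (\<Sum>i\<in>{1..M}. \<P>(\<omega> in \<Omega>. snr a b c \<sigma> t\<^sub>1 t\<^sub>2 P (g i \<omega>) (h i \<omega>) \<le> x)) / M"
proof -
  interpret prob_space \<Omega> by fact
  let ?N = "Pi\<^sub>M (channel_indices M) (\<lambda>_. borel :: real measure)"
  let ?gains = "\<lambda>\<omega>. \<lambda>k\<in>channel_indices M. channel_gain g h k \<omega>"
  have S: "S \<in> measurable \<Omega> (count_space UNIV)" "S ` space \<Omega> \<subseteq> {1..M}"
      "distr \<Omega> (count_space UNIV) S = measure_pmf (pmf_of_set {1..M})"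
    and indep: "indep_set (sets (vimage_algebra (space \<Omega>) S (count_space UNIV)))
      (sets (vimage_algebra (space \<Omega>) ?gains ?N))"
    using sel by (auto simp: random_selection_def)
  have "outage_RS \<Omega> g h S a b c \<sigma> t\<^sub>1 t\<^sub>2 P x =
    (\<Sum>i\<in>{1..M}. \<P>(\<omega> in \<Omega>. snr a b c \<sigma> t\<^sub>1 t\<^sub>2 P (g i \<omega>) (h i \<omega>) \<le> x)) / card {1..M}"
    unfolding outage_RS_def
  proof (rule prob_uniform_selection[OF S(1,2) _ _ S(3) indep])
    fix i assume "i \<in> {1..M}"
    then have idx[measurable]: "Inl i \<in> channel_indices M" "Inr i \<in> channel_indices M"
      by (auto simp: channel_indices_def)
    \<comment> \<open>The outage condition in coordinates of the gain vector:
      \<open>y (Inl i)\<close> stands for the gain of \<open>g i\<close> and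
      \<open>y (Inr i)\<close> for that of \<open>h i\<close>. The outage event is the preimage of
      \<open>A\<close>.\<close>
    define A where "A = {y\<in>space ?N. y (Inr i) / (t\<^sub>2 * \<sigma>\<^sup>2) *
      (t\<^sub>1 * ((a * P * y (Inl i) + b) / (P * y (Inl i) + c) - b / c)) \<le> x}"
    have "A \<in> sets ?N"
      unfolding A_def by measurable
    then have "?gains -` A \<inter> space \<Omega> \<in> sets (vimage_algebra (space \<Omega>) ?gains ?N)"
      by (rule in_vimage_algebra)
    also have "?gains -` A \<inter> space \<Omega> =
        {\<omega>\<in>space \<Omega>. snr a b c \<sigma> t\<^sub>1 t\<^sub>2 P (g i \<omega>) (h i \<omega>) \<le> x}"
      using idx by (auto simp: A_def space_PiM channel_gain_def snr_def harvested_energy_def)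
    finally show "{\<omega>\<in>space \<Omega>. snr a b c \<sigma> t\<^sub>1 t\<^sub>2 P (g i \<omega>) (h i \<omega>) \<le> x}
      \<in> sets (vimage_algebra (space \<Omega>) ?gains ?N)" .
  qed (use \<open>M \<ge> 1\<close> in auto)
  then show ?thesis by simp
qed

theorem mainTheorem9:
  fixes \<Omega> :: "'w measure"
    and M :: nat
    and g h :: "nat \<Rightarrow> 'w \<Rightarrow> complex"
    and S :: "'w \<Rightarrow> nat"
    and a b c \<sigma> t\<^sub>1 t\<^sub>2 x :: real
  assumes "prob_space \<Omega>"
    and "M \<ge> 1"
    and "iid_exponential_gains \<Omega> M g h"
    and "random_selection \<Omega> M g h S"
    and "\<sigma>\<^sup>2 > 0"
    and "0 < t\<^sub>1" and "t\<^sub>1 < 1" and "t\<^sub>2 = 1 - t\<^sub>1"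
    and "c > 0" and "a * c - b > 0"
    and "x > 0"
  shows "((\<lambda>P\<^sub>t. outage_RS \<Omega> g h S a b c \<sigma> t\<^sub>1 t\<^sub>2 P\<^sub>t x) \<longlongrightarrow>
           1 - exp (- (\<sigma>\<^sup>2 * c * t\<^sub>2 * x) / (t\<^sub>1 * (a * c - b)))) at_top"
proof -
  interpret prob_space \<Omega> by fact
  have device: "((\<lambda>P. \<P>(\<omega> in \<Omega>. snr a b c \<sigma> t\<^sub>1 t\<^sub>2 P (g i \<omega>) (h i \<omega>) \<le> x)) \<longlongrightarrow>
      1 - exp (- (\<sigma>\<^sup>2 * c * t\<^sub>2 * x) / (t\<^sub>1 * (a * c - b)))) at_top" if "i \<in> {1..M}" for i
  proof (rule tendsto_device_outage)
    have gain: "distributed \<Omega> lborel (channel_gain g h k) (exponential_density 1)"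
      if "k \<in> channel_indices M" for k
      using assms(3) that by (simp add: iid_exponential_gains_def)
    show "distributed \<Omega> lborel (\<lambda>\<omega>. (cmod (g i \<omega>))\<^sup>2) (exponential_density 1)"
      using gain[of "Inl i"] that by (simp add: channel_indices_def Plus_def channel_gain_def[abs_def])
    show "distributed \<Omega> lborel (\<lambda>\<omega>. (cmod (h i \<omega>))\<^sup>2) (exponential_density 1)"
      using gain[of "Inr i"] that by (simp add: channel_indices_def Plus_def channel_gain_def[abs_def])
  qed (use assms in auto)
  let ?L = "1 - exp (- (\<sigma>\<^sup>2 * c * t\<^sub>2 * x) / (t\<^sub>1 * (a * c - b)))"
  \<comment> \<open>\<open>M\<close> is fixed, so the limit passes through the finite average, and
    averaging equal limits changes nothing.\<close>
  have "((\<lambda>P. (\<Sum>i\<in>{1..M}. \<P>(\<omega> in \<Omega>. snr a b c \<sigma> t\<^sub>1 t\<^sub>2 P (g i \<omega>) (h i \<omega>) \<le> x)) / M)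
      \<longlongrightarrow> (\<Sum>i\<in>{1..M}. ?L) / M) at_top"
    using \<open>M \<ge> 1\<close> by (intro tendsto_divide tendsto_sum device tendsto_const) auto
  moreover have "(\<Sum>i\<in>{1..M}. ?L) / M = ?L"
    using \<open>M \<ge> 1\<close> by simp
  ultimately show ?thesis
    by (simp only: outage_RS_eq_average[OF assms(1,2,4)])
qed

end
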